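(* Assume exogeneity and exclusion, $\{Y(0),Y(1),Y(2),S\}\perp Z$, and the rank condition that $\operatorname{Cov}(Z,D)$ has full rank. Then $$\beta_1^{\text{2SLS}}=E\left[w_1^S\beta_1^S+w_2^S\beta_2^S\right],$$ where, for a realization $s\in\mathcal S$ of $S$ and $k\in\{1,2\}$, $$w_k^s\equiv\frac{\operatorname{Cov}(\tilde P_1,s_k(Z))}{\operatorname{Var}(\tilde P_1)},\qquad \beta_k^s\equiv E[\beta_k\mid S=s].$$
   Context: Setting: on a probability space there are a treatment $T\in\{0,1,2\}$, an outcome $Y\in\mathbb R$ and an instrument vector $Z\in\mathcal Z\subseteq\mathbb R^m$, $m\ge 2$. $\mathcal S$ is the set of all mappings $\mathcal Z\to\{0,1,2\}$ (response types); the random element $S\in\mathcal S$ describes potential treatment choices, so $T=S(Z)$. $Y(0),Y(1),Y(2)$ are potential outcomes, $Y=Y(T)$. Treatment effects of interest $\beta=(\beta_1,\beta_2)^T$ (two relative treatment effects, each a difference of two potential outcomes) come with treatment indicators $D=(D_1,D_2)^T$, $D_k=\mathbf 1[T\in R_k]$, $R_k\subset\{0,1,2\}$, chosen so that $Y=\alpha+D_1\beta_1+D_2\beta_2$ with $\alpha$ a function of $Y(0),Y(1),Y(2)$. Leading cases: unordered, $\beta=(Y(1)-Y(0),Y(2)-Y(0))^T$, $D_k=\mathbf 1[T=k]$; ordered, $\beta=(Y(1)-Y(0),Y(2)-Y(1))^T$, $D_k=\mathbf 1[T\ge k]$. For $s\in\mathcal S$, $s_k(z)=\mathbf 1[s(z)\in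 R_k]$. $\operatorname{Cov}(A,B)=E[(A-E[A])(B-E[B])^T]$, $\operatorname{Var}(A)=\operatorname{Cov}(A,A)$. Relevant moments are finite and $\operatorname{Var}(Z)$ is invertible. The predicted treatments are $P=(P_1,P_2)^T=E[D]+\operatorname{Cov}(D,Z)\operatorname{Var}(Z)^{-1}(Z-E[Z])$; $\beta^{\text{2SLS}}=(\beta_1^{\text{2SLS}},\beta_2^{\text{2SLS}})^T=\operatorname{Var}(P)^{-1}\operatorname{Cov}(P,Y)$; $\tilde P_1=P_1-\frac{\operatorname{Cov}(P_1,P_2)}{\operatorname{Var}(P_2)}P_2$.
   Formalization: S takes values in a measurable space of response types on which (s,z) ↦ s(z) is jointly measurable: all mappings if 𝒵 is countable, otherwise possibly only a subset of them; without joint measurability S(Z) may escape the independence of S and Z and the identity can fail. *)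

theory Defs
  imports "HOL-Probability.Probability"
begin

text \<open>Covariances are taken entry by entry; \<open>Var(A)\<close> is \<open>Cov(A, A)\<close>. The
  \<open>(i, j)\<close> entry of \<open>cov_mat M A B\<close> is \<open>Cov(A_i, B_j)\<close>, so \<open>E[(A - E A)(B - E B)\<^sup>T]\<close> has one row
  for each component of \<open>A\<close>.\<close>

definition cov :: "'a measure \<Rightarrow> ('a \<Rightarrow> real) \<Rightarrow> ('a \<Rightarrow> real) \<Rightarrow> real" where
  "cov M A B = (\<integral>\<omega>. (A \<omega> - (\<integral>x. A x \<partial>M)) * (B \<omega> - (\<integral>x. B x \<partial>M)) \<partial>M)"

definition cov_mat :: "'a measure \<Rightarrow> ('a \<Rightarrow> real^'n) \<Rightarrow> ('a \<Rightarrow> real^'k) \<Rightarrow> real^'k^'n" where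
  "cov_mat M A B = (\<chi> i j. cov M (\<lambda>\<omega>. A \<omega> $ i) (\<lambda>\<omega>. B \<omega> $ j))"

definition mean_vec :: "'a measure \<Rightarrow> ('a \<Rightarrow> real^'n) \<Rightarrow> real^'n" where
  "mean_vec M A = (\<chi> i. \<integral>\<omega>. A \<omega> $ i \<partial>M)"

text \<open>The library's \<open>indep_var\<close> forces both random elements into one type, hence this version
  for random elements of different types: the generated \<open>\<sigma>\<close>-algebras are independent.\<close>

definition indep_elements ::
    "'a measure \<Rightarrow> 'b measure \<Rightarrow> ('a \<Rightarrow> 'b) \<Rightarrow> 'c measure \<Rightarrow> ('a \<Rightarrow> 'c) \<Rightarrow> bool" where
  "indep_elements M N1 X1 N2 X2 \<longleftrightarrow>
     X1 \<in> M \<rightarrow>\<^sub>M N1 \<and> X2 \<in> M \<rightarrow>\<^sub>M N2 \<and>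
     prob_space.indep_set M (sets (vimage_algebra (space M) X1 N1))
                            (sets (vimage_algebra (space M) X2 N2))"

text \<open>\<open>b\<close> is a version of \<open>s \<mapsto> E[X | S = s]\<close>, where \<open>S\<close> takes values in the measurable
  space \<open>N\<close>. Such a function is determined only up to null sets of the law of \<open>S\<close>.\<close>

definition cond_exp_given ::
    "'a measure \<Rightarrow> 's measure \<Rightarrow> ('a \<Rightarrow> 's) \<Rightarrow> ('a \<Rightarrow> real) \<Rightarrow> ('s \<Rightarrow> real) \<Rightarrow> bool" where
  "cond_exp_given M N S X b \<longleftrightarrow>
     b \<in> borel_measurable N \<and>
     (AE \<omega> in M. b (S \<omega>) = real_cond_exp M (vimage_algebra (space M) S N) X \<omega>)"

text \<open>Versions always exist, by the factorization lemma for functions measurable with respect to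
  the \<open>\<sigma>\<close>-algebra generated by \<open>S\<close>.\<close>

lemma factor_through_ennreal:
  fixes f :: "'a \<Rightarrow> ennreal"
  assumes S: "S \<in> \<Omega> \<rightarrow> space N" and f: "f \<in> borel_measurable (vimage_algebra \<Omega> S N)"
  shows "\<exists>g\<in>borel_measurable N. \<forall>x\<in>\<Omega>. f x = g (S x)"
  using f
proof (induction rule: borel_measurable_induct)
  case (cong f g)
  then show ?case by auto
next
  case (set A)
  then obtain B where "B \<in> sets N" "A = S -` B \<inter> \<Omega>"
    using S by (auto simp: sets_vimage_algebra2)
  then show ?case
    by (intro bexI[of _ "indicator B"]) (auto simp: indicator_def)
next
  case (mult u c)
  from mult.IH obtain g where "g \<in> borel_measurable N" "\<forall>x\<in>\<Omega>. u x = g (S x)" by blast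
  then show ?case by (intro bexI[of _ "\<lambda>s. c * g s"]) simp_all
next
  case (add u v)
  from add.IH obtain g h where "g \<in> borel_measurable N" "\<forall>x\<in>\<Omega>. u x = g (S x)"
    "h \<in> borel_measurable N" "\<forall>x\<in>\<Omega>. v x = h (S x)" by blast
  then show ?case by (intro bexI[of _ "\<lambda>s. h s + g s"]) simp_all
next
  case (seq U)
  from seq.IH have "\<forall>i. \<exists>g. g \<in> borel_measurable N \<and> (\<forall>x\<in>\<Omega>. U i x = g (S x))" by blast
  then obtain g where "\<forall>i. g i \<in> borel_measurable N \<and> (\<forall>x\<in>\<Omega>. U i x = g i (S x))"
    by (rule choice[THEN exE])
  then have g: "\<And>i. g i \<in> borel_measurable N" "\<And>i x. x \<in> \<Omega> \<Longrightarrow> U i x = g i (S x)" by simp_all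
  have "(\<lambda>s. SUP i. g i s) \<in> borel_measurable N"
    by (rule borel_measurable_SUP) (simp_all add: g(1))
  then show ?case
    using g(2) by (intro bexI[of _ "\<lambda>s. SUP i. g i s"]) (simp_all add: image_comp)
qed

lemma cond_exp_given_exists:
  assumes S: "S \<in> M \<rightarrow>\<^sub>M N"
  shows "\<exists>b. cond_exp_given M N S X b"
proof -
  let ?F = "vimage_algebra (space M) S N"
  let ?c = "real_cond_exp M ?F X"
  have S': "S \<in> space M \<rightarrow> space N" using measurable_space[OF S] by auto
  have c: "?c \<in> borel_measurable ?F" by (rule borel_measurable_cond_exp)
  have c1: "(\<lambda>x. ennreal (?c x)) \<in> borel_measurable ?F"
    using measurable_compose[OF c measurable_ennreal] .
  have c2: "(\<lambda>x. ennreal (- ?c x)) \<in> borel_measurable ?F"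
    using measurable_compose[OF borel_measurable_uminus[OF c] measurable_ennreal] .
  from factor_through_ennreal[OF S' c1]
  obtain g where g: "g \<in> borel_measurable N" "\<And>x. x \<in> space M \<Longrightarrow> ennreal (?c x) = g (S x)"
    by (elim bexE) (rule that, assumption, erule bspec)
  from factor_through_ennreal[OF S' c2]
  obtain h where h: "h \<in> borel_measurable N" "\<And>x. x \<in> space M \<Longrightarrow> ennreal (- ?c x) = h (S x)"
    by (elim bexE) (rule that, assumption, erule bspec)
  have "enn2real (ennreal r) - enn2real (ennreal (- r)) = r" for r
    by (cases "r \<ge> 0") (auto simp: ennreal_neg)
  then have "enn2real (g (S x)) - enn2real (h (S x)) = ?c x" if "x \<in> space M" for x
    using g(2)[OF that] h(2)[OF that] by metis
  then have "cond_exp_given M N S X (\<lambda>s. enn2real (g s) - enn2real (h s))"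
    unfolding cond_exp_given_def using g(1) h(1) by (intro conjI AE_I2) simp_all
  then show ?thesis by blast
qed

definition treat_ind :: "(2 \<Rightarrow> nat set) \<Rightarrow> ('a \<Rightarrow> nat) \<Rightarrow> 'a \<Rightarrow> real^2" where
  "treat_ind R T \<omega> = (\<chi> k. indicator (R k) (T \<omega>))"

definition pred_treat :: "'a measure \<Rightarrow> ('a \<Rightarrow> real^2) \<Rightarrow> ('a \<Rightarrow> real^'m) \<Rightarrow> 'a \<Rightarrow> real^2" where
  "pred_treat M D Z \<omega> =
     mean_vec M D + (cov_mat M D Z ** matrix_inv (cov_mat M Z Z)) *v (Z \<omega> - mean_vec M Z)"

definition beta_2sls ::
    "'a measure \<Rightarrow> ('a \<Rightarrow> real^2) \<Rightarrow> ('a \<Rightarrow> real^'m) \<Rightarrow> ('a \<Rightarrow> real) \<Rightarrow> real^2" where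
  "beta_2sls M D Z Y =
     matrix_inv (cov_mat M (pred_treat M D Z) (pred_treat M D Z)) *v
     (\<chi> k. cov M (\<lambda>\<omega>. pred_treat M D Z \<omega> $ k) Y)"

text \<open>\<open>resid_pred M D Z\<close> is the residualized first predicted treatment.\<close>

definition resid_pred :: "'a measure \<Rightarrow> ('a \<Rightarrow> real^2) \<Rightarrow> ('a \<Rightarrow> real^'m) \<Rightarrow> 'a \<Rightarrow> real" where
  "resid_pred M D Z \<omega> =
     (let P1 = (\<lambda>x. pred_treat M D Z x $ 1); P2 = (\<lambda>x. pred_treat M D Z x $ 2)
      in P1 \<omega> - cov M P1 P2 / cov M P2 P2 * P2 \<omega>)"

definition tsls_weight ::
    "'a measure \<Rightarrow> (2 \<Rightarrow> nat set) \<Rightarrow> ('a \<Rightarrow> real^2) \<Rightarrow> ('a \<Rightarrow> real^'m) \<Rightarrow> 2 \<Rightarrow> (real^'m \<Rightarrow> nat) \<Rightarrow> real" where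
  "tsls_weight M R D Z k s =
     cov M (resid_pred M D Z) (\<lambda>\<omega>. indicator (R k) (s (Z \<omega>))) /
     cov M (resid_pred M D Z) (resid_pred M D Z)"

text \<open>A measurable space of response types on the instrument support \<open>\<Z>\<close>. A mapping is
  represented as an extensional function on \<open>\<Z>\<close>. Joint measurability of evaluation makes
  \<open>T = S(Z)\<close> a random variable and \<open>s(Z)\<close> one for each \<open>s\<close>. For countable \<open>\<Z>\<close> the
  space can be the set of all mappings (see below). For uncountable \<open>\<Z>\<close> evaluation is in general not
  jointly measurable on the set of all mappings for any choice of \<open>\<sigma>\<close>-algebra, so the
  space is allowed to be a subset of it.\<close>

definition response_type_space :: "(real^'m) set \<Rightarrow> (real^'m \<Rightarrow> nat) measure \<Rightarrow> bool" where
  "response_type_space \<Z> N \<longleftrightarrow>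
     space N \<subseteq> (\<Z> \<rightarrow>\<^sub>E {0, 1, 2}) \<and>
     (\<lambda>(s, z). s z) \<in> N \<Otimes>\<^sub>M restrict_space borel \<Z> \<rightarrow>\<^sub>M count_space {0, 1, 2}"

lemma response_type_space_countable:
  fixes \<Z> :: "(real^'m) set"
  assumes Z: "countable \<Z>"
  shows "response_type_space \<Z> (PiM \<Z> (\<lambda>_. count_space {0, 1, 2}))"
proof -
  let ?N = "PiM \<Z> (\<lambda>_. count_space {0, 1, 2::nat})"
  have id: "(\<lambda>z. z) \<in> restrict_space borel \<Z> \<rightarrow>\<^sub>M count_space \<Z>"
  proof (rule measurableI)
    fix A assume "A \<in> sets (count_space \<Z>)"
    then have A: "A \<subseteq> \<Z>" by simp
    have "A \<in> sets borel"
      by (rule sets.countable[OF _ countable_subset[OF A Z]]) simp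
    then have "\<Z> \<inter> A \<in> sets (restrict_space borel \<Z>)" by (auto simp: sets_restrict_space)
    then show "(\<lambda>z. z) -` A \<inter> space (restrict_space borel \<Z>) \<in> sets (restrict_space borel \<Z>)"
      by (simp add: space_restrict_space Int_commute)
  qed (simp add: space_restrict_space)
  have "(\<lambda>x. (\<lambda>z x. fst x z) (snd x) x)
      \<in> ?N \<Otimes>\<^sub>M restrict_space borel \<Z> \<rightarrow>\<^sub>M count_space {0, 1, 2}"
  proof (rule measurable_compose_countable'[OF _ _ Z])
    show "(\<lambda>x. fst x z) \<in> ?N \<Otimes>\<^sub>M restrict_space borel \<Z> \<rightarrow>\<^sub>M count_space {0, 1, 2}"
      if "z \<in> \<Z>" for z
      using measurable_compose[OF measurable_fst measurable_component_singleton[OF that]] .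
    show "snd \<in> ?N \<Otimes>\<^sub>M restrict_space borel \<Z> \<rightarrow>\<^sub>M count_space \<Z>"
      using measurable_compose[OF measurable_snd id] by simp
  qed
  then show ?thesis
    by (simp add: response_type_space_def space_PiM case_prod_beta')
qed

end

theory Submission
  imports Defs
begin

text \<open>The coefficient \<open>\<beta>\<^sub>1\<close> of the regression of \<open>Y\<close> on \<open>(P\<^sub>1, P\<^sub>2)\<close> is that of the regression of
  \<open>Y\<close> on the residual of \<open>P\<^sub>1\<close>, which is an affine function of \<open>Z\<close>. In
  \<open>Y = \<alpha> + D\<^sub>1 \<beta>\<^sub>1 + D\<^sub>2 \<beta>\<^sub>2\<close> the term \<open>\<alpha>\<close> is independent of \<open>Z\<close> and drops out of the covariance;
  in the other two, \<open>D\<^sub>k\<close> is the indicator of \<open>S(Z) \<in> R\<^sub>k\<close>, and integrating out \<open>Z\<close> first (Fubini)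
  leaves the weight of the response type times \<open>\<beta>\<^sub>k\<close>, whose expectation is unchanged when \<open>\<beta>\<^sub>k\<close>
  is replaced by \<open>E[\<beta>\<^sub>k | S]\<close>. That \<open>Var(P)\<close> is nonsingular follows from
  \<open>Cov(Z, P) = Cov(Z, D)\<close> and the rank condition.\<close>

section \<open>Covariances\<close>

lemma cov_commute: "cov M A B = cov M B A"
  by (simp add: cov_def mult.commute)

text \<open>The inequality 2|fg| \<le> f^2 + g^2 makes f^2 + g^2 an integrable bound. This is how
  second moments of the instruments give the mixed moments.\<close>

lemma integrable_mult_of_squares:
  fixes f g :: "'a \<Rightarrow> real"
  assumes [measurable]: "f \<in> borel_measurable M" "g \<in> borel_measurable M"
    and f: "integrable M (\<lambda>x. (f x)\<^sup>2)" and g: "integrable M (\<lambda>x. (g x)\<^sup>2)"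
  shows "integrable M (\<lambda>x. f x * g x)"
proof (rule Bochner_Integration.integrable_bound[OF Bochner_Integration.integrable_add[OF f g]])
  show "AE x in M. norm (f x * g x) \<le> norm ((f x)\<^sup>2 + (g x)\<^sup>2)"
  proof (rule AE_I2)
    fix x
    have "2 * (\<bar>f x\<bar> * \<bar>g x\<bar>) \<le> (f x)\<^sup>2 + (g x)\<^sup>2"
      using sum_squares_bound[of "\<bar>f x\<bar>" "\<bar>g x\<bar>"] by simp
    moreover have "0 \<le> \<bar>f x\<bar> * \<bar>g x\<bar>" by simp
    ultimately have "\<bar>f x\<bar> * \<bar>g x\<bar> \<le> (f x)\<^sup>2 + (g x)\<^sup>2" by linarith
    then show "norm (f x * g x) \<le> norm ((f x)\<^sup>2 + (g x)\<^sup>2)"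
      by (simp add: abs_mult)
  qed
qed simp

context prob_space
begin

lemma cov_eq_expectation:
  assumes [simp]: "integrable M A" "integrable M B" "integrable M (\<lambda>\<omega>. A \<omega> * B \<omega>)"
  shows "cov M A B = expectation (\<lambda>\<omega>. A \<omega> * B \<omega>) - expectation A * expectation B"
proof -
  have "cov M A B = expectation (\<lambda>\<omega>. A \<omega> * B \<omega> - expectation A * B \<omega> - expectation B * A \<omega>
      + expectation A * expectation B)"
    unfolding cov_def by (simp add: algebra_simps)
  also have "\<dots> = expectation (\<lambda>\<omega>. A \<omega> * B \<omega>) - expectation A * expectation B"
    by (simp add: prob_space)
  finally show ?thesis .
qed

text \<open>Centering one factor is enough, because A - E[A] has mean zero and so is orthogonal to
  the constant E[B]. With A a function of Z, the integrand becomes a mean-zero function of Z times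
  the other variable.\<close>

lemma cov_eq_centered_integral:
  assumes "integrable M A" "integrable M B" "integrable M (\<lambda>\<omega>. A \<omega> * B \<omega>)"
  shows "integrable M (\<lambda>\<omega>. (A \<omega> - expectation A) * B \<omega>)"
    and "cov M A B = expectation (\<lambda>\<omega>. (A \<omega> - expectation A) * B \<omega>)"
  using assms by (simp_all add: cov_eq_expectation left_diff_distrib)

text \<open>The constant c is carried along because predicted treatments are affine in Z; it drops
  out of the covariance. The left-hand version follows by \<open>cov_commute\<close>.\<close>

lemma cov_affine_right:
  assumes A[simp]: "integrable M A" and B[simp]: "\<And>i. i \<in> I \<Longrightarrow> integrable M (B i)"
    and AB[simp]: "\<And>i. i \<in> I \<Longrightarrow> integrable M (\<lambda>\<omega>. A \<omega> * B i \<omega>)"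
  shows "cov M A (\<lambda>\<omega>. c + (\<Sum>i\<in>I. u i * B i \<omega>)) = (\<Sum>i\<in>I. u i * cov M A (B i))"
proof -
  have eq: "A \<omega> * (c + (\<Sum>i\<in>I. u i * B i \<omega>)) = c * A \<omega> + (\<Sum>i\<in>I. u i * (A \<omega> * B i \<omega>))" for \<omega>
    by (simp add: distrib_left sum_distrib_left mult_ac)
  have "expectation (\<lambda>\<omega>. c * A \<omega> + (\<Sum>i\<in>I. u i * (A \<omega> * B i \<omega>))) =
      c * expectation A + (\<Sum>i\<in>I. u i * expectation (\<lambda>\<omega>. A \<omega> * B i \<omega>))"
    by simp
  moreover have "expectation (\<lambda>\<omega>. c + (\<Sum>i\<in>I. u i * B i \<omega>)) =
      c + (\<Sum>i\<in>I. u i * expectation (B i))"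
    by (simp add: prob_space)
  ultimately have "cov M A (\<lambda>\<omega>. c + (\<Sum>i\<in>I. u i * B i \<omega>)) =
      (\<Sum>i\<in>I. u i * expectation (\<lambda>\<omega>. A \<omega> * B i \<omega>))
      - expectation A * (\<Sum>i\<in>I. u i * expectation (B i))"
    by (subst cov_eq_expectation) (simp_all only: eq, simp_all add: distrib_left mult.commute)
  also have "\<dots> = (\<Sum>i\<in>I. u i * cov M A (B i))"
    by (simp add: cov_eq_expectation sum_distrib_left right_diff_distrib sum_subtractf mult_ac)
  finally show ?thesis .
qed

lemmas cov_linear_right = cov_affine_right[where c = 0, simplified]

text \<open>A variable of variance zero equals its mean almost surely, so the integrand defining the
  covariance vanishes almost everywhere.\<close>

lemma cov_self_eq_0D:
  assumes [measurable]: "A \<in> borel_measurable M" and sq: "integrable M (\<lambda>\<omega>. (A \<omega>)\<^sup>2)"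
    and "cov M A A = 0"
  shows "cov M B A = 0"
proof -
  have [simp]: "integrable M A" using square_integrable_imp_integrable[OF _ sq] by simp
  have "integrable M (\<lambda>\<omega>. (A \<omega> - expectation A)\<^sup>2)"
    using sq by (simp add: power2_diff)
  with assms(3) have "AE \<omega> in M. (A \<omega> - expectation A)\<^sup>2 = 0"
    by (subst integral_nonneg_eq_0_iff_AE[symmetric]) (simp_all add: cov_def power2_eq_square)
  then show ?thesis
    unfolding cov_def by (intro integral_eq_zero_AE) auto
qed

end

section \<open>Predicted treatments\<close>

lemma matrix_inv_left: "invertible A \<Longrightarrow> matrix_inv A ** A = mat 1"
  and matrix_inv_right: "invertible A \<Longrightarrow> A ** matrix_inv A = mat 1"
  unfolding invertible_def matrix_inv_def by (metis (mono_tags, lifting) someI)+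

text \<open>The slopes are row k of the first-stage coefficient matrix. The intercept stays
  existential, since no covariance depends on it.\<close>

lemma pred_treat_component_affine:
  "\<exists>c. \<forall>\<omega>. pred_treat M D Z \<omega> $ k = c + (\<Sum>j\<in>UNIV.
    (cov_mat M D Z ** matrix_inv (cov_mat M Z Z)) $ k $ j * Z \<omega> $ j)"
proof (intro exI allI)
  let ?u = "(cov_mat M D Z ** matrix_inv (cov_mat M Z Z)) $ k"
  show "pred_treat M D Z \<omega> $ k = (mean_vec M D $ k - (\<Sum>j\<in>UNIV. ?u $ j * mean_vec M Z $ j))
      + (\<Sum>j\<in>UNIV. ?u $ j * Z \<omega> $ j)" for \<omega>
    by (simp add: pred_treat_def matrix_vector_mult_def right_diff_distrib sum_subtractf)
qed

lemma pred_treat_eq_measurable: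
  fixes Z :: "'a \<Rightarrow> real^'m"
  shows "\<exists>f\<in>borel_measurable borel. \<forall>\<omega>. pred_treat M D Z \<omega> $ k = f (Z \<omega>)"
proof -
  obtain c where "\<And>\<omega>. pred_treat M D Z \<omega> $ k = c + (\<Sum>j\<in>UNIV.
      (cov_mat M D Z ** matrix_inv (cov_mat M Z Z)) $ k $ j * Z \<omega> $ j)"
    using pred_treat_component_affine by blast
  then show ?thesis
    by (intro bexI[of _ "\<lambda>z. c + (\<Sum>j\<in>UNIV.
        (cov_mat M D Z ** matrix_inv (cov_mat M Z Z)) $ k $ j * z $ j)"]
        borel_measurable_continuous_onI continuous_intros) blast
qed

text \<open>Being a Borel function of Z is what lets the residual inherit independence from
  potential outcomes and response types.\<close>

lemma resid_pred_eq_measurable: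
  fixes Z :: "'a \<Rightarrow> real^'m"
  obtains h where "h \<in> borel_measurable borel" "resid_pred M D Z = (\<lambda>\<omega>. h (Z \<omega>))"
proof -
  obtain f g where "f \<in> borel_measurable borel" "\<And>\<omega>. pred_treat M D Z \<omega> $ 1 = f (Z \<omega>)"
    "g \<in> borel_measurable borel" "\<And>\<omega>. pred_treat M D Z \<omega> $ 2 = g (Z \<omega>)"
    using pred_treat_eq_measurable by metis
  then show thesis
    by (intro that[of "\<lambda>z. f z - cov M (\<lambda>x. f (Z x)) (\<lambda>x. g (Z x)) /
        cov M (\<lambda>x. g (Z x)) (\<lambda>x. g (Z x)) * g z"])
      (simp_all add: resid_pred_def Let_def fun_eq_iff)
qed

context prob_space
begin

context
  fixes D :: "'a \<Rightarrow> real^2" and Z :: "'a \<Rightarrow> real^'m"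
  assumes meas_Z[measurable]: "\<And>i. (\<lambda>\<omega>. Z \<omega> $ i) \<in> borel_measurable M"
    and sq_Z: "\<And>i. integrable M (\<lambda>\<omega>. (Z \<omega> $ i)\<^sup>2)"
begin

lemma integrable_instrument: "integrable M (\<lambda>\<omega>. Z \<omega> $ i)"
  by (rule square_integrable_imp_integrable[OF _ sq_Z]) simp

lemma integrable_mult_pred_treat:
  assumes "integrable M X" and XZ: "\<And>j. integrable M (\<lambda>\<omega>. X \<omega> * Z \<omega> $ j)"
  shows "integrable M (\<lambda>\<omega>. X \<omega> * pred_treat M D Z \<omega> $ k)"
proof -
  let ?u = "(cov_mat M D Z ** matrix_inv (cov_mat M Z Z)) $ k"
  obtain c where *: "\<And>\<omega>. pred_treat M D Z \<omega> $ k = c + (\<Sum>j\<in>UNIV. ?u $ j * Z \<omega> $ j)"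
    using pred_treat_component_affine by blast
  have "integrable M (\<lambda>\<omega>. X \<omega> * c + (\<Sum>j\<in>UNIV. ?u $ j * (X \<omega> * Z \<omega> $ j)))"
    using assms by simp
  then show ?thesis
    by (simp add: * distrib_left sum_distrib_left mult_ac)
qed

lemma integrable_pred_treat: "integrable M (\<lambda>\<omega>. pred_treat M D Z \<omega> $ k)"
  using integrable_mult_pred_treat[of "\<lambda>_. 1"] by (simp add: integrable_instrument)

lemma integrable_instrument_mult_pred_treat:
  "integrable M (\<lambda>\<omega>. Z \<omega> $ i * pred_treat M D Z \<omega> $ k)"
  by (intro integrable_mult_pred_treat integrable_instrument integrable_mult_of_squares sq_Z) simp_all

lemma integrable_pred_treat_mult_pred_treat:
  "integrable M (\<lambda>\<omega>. pred_treat M D Z \<omega> $ l * pred_treat M D Z \<omega> $ k)"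
proof (rule integrable_mult_pred_treat[OF integrable_pred_treat])
  show "integrable M (\<lambda>\<omega>. pred_treat M D Z \<omega> $ l * Z \<omega> $ j)" for j
    using integrable_instrument_mult_pred_treat[of j l] by (simp add: mult.commute)
qed

text \<open>These are the first-stage normal equations: the prediction error D - P is uncorrelated
  with every instrument, because multiplying Cov(D,Z) Var(Z)^(-1) by Var(Z) returns
  Cov(D,Z).\<close>

lemma cov_instrument_pred_treat:
  assumes inv: "invertible (cov_mat M Z Z)"
  shows "cov M (\<lambda>\<omega>. Z \<omega> $ i) (\<lambda>\<omega>. pred_treat M D Z \<omega> $ k) =
    cov M (\<lambda>\<omega>. Z \<omega> $ i) (\<lambda>\<omega>. D \<omega> $ k)"
proof -
  let ?A = "cov_mat M D Z ** matrix_inv (cov_mat M Z Z)"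
  obtain c where *: "\<And>\<omega>. pred_treat M D Z \<omega> $ k = c + (\<Sum>j\<in>UNIV. ?A $ k $ j * Z \<omega> $ j)"
    using pred_treat_component_affine by blast
  have "?A ** cov_mat M Z Z = cov_mat M D Z"
    by (simp add: matrix_mul_assoc[symmetric] matrix_inv_left[OF inv])
  then have "(?A ** cov_mat M Z Z) $ k $ i = cov_mat M D Z $ k $ i"
    by simp
  then have "(\<Sum>j\<in>UNIV. ?A $ k $ j * cov M (\<lambda>\<omega>. Z \<omega> $ j) (\<lambda>\<omega>. Z \<omega> $ i)) =
      cov M (\<lambda>\<omega>. D \<omega> $ k) (\<lambda>\<omega>. Z \<omega> $ i)"
    unfolding matrix_matrix_mult_def[of ?A] by (simp add: cov_mat_def)
  moreover have "cov M (\<lambda>\<omega>. Z \<omega> $ i) (\<lambda>\<omega>. pred_treat M D Z \<omega> $ k) =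
      (\<Sum>j\<in>UNIV. ?A $ k $ j * cov M (\<lambda>\<omega>. Z \<omega> $ i) (\<lambda>\<omega>. Z \<omega> $ j))"
    unfolding *
    by (intro cov_affine_right integrable_instrument integrable_mult_of_squares sq_Z) simp_all
  ultimately show ?thesis
    by (simp add: cov_commute[of M _ "\<lambda>\<omega>. Z \<omega> $ i"])
qed

text \<open>If Var(P) x = 0, the combination Q = x_1 P_1 + x_2 P_2 has variance zero and is
  therefore uncorrelated with Z. Since Cov(Z,P) = Cov(Z,D), this says Cov(Z,D) x = 0, and full
  column rank forces x = 0.\<close>

lemma cov_pred_treat_kernel_trivial:
  assumes inv: "invertible (cov_mat M Z Z)" and rank: "rank (cov_mat M Z D) = 2"
    and Vx: "cov_mat M (pred_treat M D Z) (pred_treat M D Z) *v x = 0"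
  shows "x = 0"
proof -
  let ?P = "\<lambda>k \<omega>. pred_treat M D Z \<omega> $ k"
  define Q where "Q = (\<lambda>\<omega>. \<Sum>k\<in>UNIV. x $ k * ?P k \<omega>)"
  note [simp] = integrable_pred_treat integrable_pred_treat_mult_pred_treat
    integrable_instrument integrable_instrument_mult_pred_treat
  have cov_Q: "cov M X Q = (\<Sum>k\<in>UNIV. x $ k * cov M X (?P k))"
    if "integrable M X" "\<And>k. integrable M (\<lambda>\<omega>. X \<omega> * ?P k \<omega>)" for X
    unfolding Q_def using that by (intro cov_linear_right) simp_all
  have Q_int: "integrable M Q"
    unfolding Q_def by simp
  have QP: "integrable M (\<lambda>\<omega>. Q \<omega> * ?P k \<omega>)" for k
    unfolding Q_def sum_distrib_right mult.assoc by simp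
  have PQ: "cov M (?P k) Q = 0" for k
  proof -
    have "cov M (?P k) Q = (\<Sum>l\<in>UNIV. x $ l * cov M (?P k) (?P l))"
      by (rule cov_Q) (simp_all add: Q_int QP)
    also have "\<dots> = (cov_mat M (pred_treat M D Z) (pred_treat M D Z) *v x) $ k"
      by (simp add: matrix_vector_mult_def cov_mat_def mult.commute)
    finally show ?thesis by (simp add: Vx)
  qed
  have "cov M Q Q = (\<Sum>k\<in>UNIV. x $ k * cov M Q (?P k))"
    by (rule cov_Q) (simp_all add: Q_int QP)
  then have "cov M Q Q = 0"
    using PQ by (simp add: cov_commute[of M Q "?P k" for k])
  \<comment> \<open>Expanding only one of the two factors leaves the terms Q P_k, whose
    integrability is \<open>QP\<close>.\<close>
  moreover have "(Q \<omega>)\<^sup>2 = (\<Sum>k\<in>UNIV. x $ k * (Q \<omega> * ?P k \<omega>))" for \<omega>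
  proof -
    have "(Q \<omega>)\<^sup>2 = Q \<omega> * (\<Sum>k\<in>UNIV. x $ k * ?P k \<omega>)"
      unfolding power2_eq_square by (simp only: Q_def)
    then show ?thesis
      by (simp add: sum_distrib_left mult.left_commute)
  qed
  then have "integrable M (\<lambda>\<omega>. (Q \<omega>)\<^sup>2)"
    using QP by simp
  moreover have "Q \<in> borel_measurable M"
    by (rule borel_measurable_integrable[OF Q_int])
  ultimately have ZQ: "cov M (\<lambda>\<omega>. Z \<omega> $ i) Q = 0" for i
    by - (rule cov_self_eq_0D)
  have "cov_mat M Z D *v x = 0"
  proof (rule vec_eq_iff[THEN iffD2, rule_format])
    fix i
    have "cov M (\<lambda>\<omega>. Z \<omega> $ i) Q = (\<Sum>k\<in>UNIV. x $ k * cov M (\<lambda>\<omega>. Z \<omega> $ i) (?P k))"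
      by (rule cov_Q) (simp_all add: Q_int QP)
    then show "(cov_mat M Z D *v x) $ i = 0 $ i"
      using ZQ[of i]
      by (simp add: matrix_vector_mult_def cov_mat_def cov_instrument_pred_treat[OF inv] mult.commute)
  qed
  moreover have "inj ((*v) (cov_mat M Z D))"
    using rank full_rank_injective[of "cov_mat M Z D"] by simp
  ultimately show ?thesis
    by (metis injD matrix_vector_mult_0_right)
qed

lemma integrable_resid_pred: "integrable M (resid_pred M D Z)"
  unfolding resid_pred_def Let_def
  using integrable_pred_treat by (intro Bochner_Integration.integrable_diff integrable_mult_right)

text \<open>This is the Frisch-Waugh-Lovell argument: the residual P_1 - r P_2 is uncorrelated with
  P_2, so subtracting r times the second normal equation from the first eliminates the second
  coefficient.\<close>

lemma beta_2sls_1_eq_residual_regression: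
  assumes inv: "invertible (cov_mat M Z Z)" and rank: "rank (cov_mat M Z D) = 2"
    and Y: "integrable M Y" and YZ: "\<And>j. integrable M (\<lambda>\<omega>. Y \<omega> * Z \<omega> $ j)"
  shows "beta_2sls M D Z Y $ 1 =
    cov M (resid_pred M D Z) Y / cov M (resid_pred M D Z) (resid_pred M D Z)"
proof -
  let ?P = "\<lambda>k \<omega>. pred_treat M D Z \<omega> $ k"
  define V where "V = cov_mat M (pred_treat M D Z) (pred_treat M D Z)"
  define r where "r = V $ 1 $ 2 / V $ 2 $ 2"
  \<comment> \<open>The coefficients (1, -r) of the residual in (P_1, P_2), which bring it into the
    form of \<open>cov_linear_right\<close>.\<close>
  define u :: "2 \<Rightarrow> real" where "u = (\<lambda>k. if k = 1 then 1 else - r)"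
  define Rs where "Rs = resid_pred M D Z"
  define y :: "real^2" where "y = (\<chi> k. cov M (?P k) Y)"
  note [simp] = integrable_pred_treat integrable_pred_treat_mult_pred_treat
  have V: "cov M (?P k) (?P l) = V $ k $ l" for k l
    by (simp add: V_def cov_mat_def)
  have V_sym: "V $ 2 $ 1 = V $ 1 $ 2"
    by (simp add: V_def cov_mat_def cov_commute)
  have ker: "x = 0" if "V *v x = 0" for x
    using cov_pred_treat_kernel_trivial[OF inv rank] that unfolding V_def by blast
  \<comment> \<open>If P_2 had variance zero, its covariance with P_1 would vanish too, and the
    second unit vector would lie in the kernel of V.\<close>
  have V22: "V $ 2 $ 2 \<noteq> 0"
  proof
    assume 0: "V $ 2 $ 2 = 0"
    have "integrable M (\<lambda>\<omega>. (?P 2 \<omega>)\<^sup>2)" by (simp add: power2_eq_square)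
    then have "cov M (?P 1) (?P 2) = 0"
      by (rule cov_self_eq_0D[rotated]) (simp_all add: V 0 borel_measurable_integrable)
    with 0 have "V *v (\<chi> k. if k = 1 then 0 else 1) = 0"
      by (simp add: V vec_eq_iff forall_2 matrix_vector_mult_def sum_2)
    from ker[OF this] show False by (simp add: vec_eq_iff forall_2)
  qed
  have Rs: "Rs = (\<lambda>\<omega>. \<Sum>k\<in>UNIV. u k * ?P k \<omega>)"
    by (simp add: Rs_def resid_pred_def Let_def sum_2 u_def r_def V fun_eq_iff)
  have Rs_int: "integrable M Rs" unfolding Rs by simp
  have RsP: "integrable M (\<lambda>\<omega>. Rs \<omega> * ?P k \<omega>)" for k
    unfolding Rs sum_distrib_right mult.assoc by simp
  have cov_Rs: "cov M X Rs = cov M X (?P 1) - r * cov M X (?P 2)"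
    if "integrable M X" "\<And>k. integrable M (\<lambda>\<omega>. X \<omega> * ?P k \<omega>)" for X
    unfolding Rs using that by (subst cov_linear_right) (simp_all add: sum_2 u_def)
  have "cov M Rs (?P k) = V $ k $ 1 - r * V $ k $ 2" for k
    by (subst cov_commute, subst cov_Rs) (simp_all add: V)
  then have var: "cov M Rs Rs = V $ 1 $ 1 - r * V $ 1 $ 2"
    using V22 Rs_int RsP by (subst cov_Rs) (simp_all add: V_sym r_def)
  \<comment> \<open>V maps (1, -r) to (Var(Rs), 0): the second entry is zero by the choice of r.
    Variance zero would thus put a nonzero vector into the kernel.\<close>
  have "cov M Rs Rs \<noteq> 0"
  proof
    assume "cov M Rs Rs = 0"
    then have "V *v (\<chi> k. u k) = 0"
      using V22 by (simp add: var vec_eq_iff forall_2 matrix_vector_mult_def sum_2 u_def V_sym)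
        (simp add: r_def)
    from ker[OF this] show False by (simp add: vec_eq_iff forall_2 u_def)
  qed
  have "cov M Rs Y = y $ 1 - r * y $ 2"
    using Y YZ by (subst cov_commute, subst cov_Rs)
      (simp_all add: integrable_mult_pred_treat y_def cov_commute[of M Y])
  \<comment> \<open>A square matrix with trivial kernel is invertible, so \<open>matrix_inv\<close>
    is a genuine inverse and the estimand solves the normal equations.\<close>
  moreover have "invertible V"
    using ker unfolding invertible_left_inverse matrix_left_invertible_ker by blast
  then have "V *v beta_2sls M D Z Y = y"
    unfolding beta_2sls_def V_def[symmetric] y_def[symmetric]
    by (simp add: matrix_vector_mul_assoc matrix_inv_right)
  then have "y $ k = V $ k $ 1 * beta_2sls M D Z Y $ 1 + V $ k $ 2 * beta_2sls M D Z Y $ 2" for k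
    by (auto simp: matrix_vector_mult_def sum_2)
  then have "y $ 1 = V $ 1 $ 1 * beta_2sls M D Z Y $ 1 + V $ 1 $ 2 * beta_2sls M D Z Y $ 2"
    and "y $ 2 = V $ 1 $ 2 * beta_2sls M D Z Y $ 1 + V $ 2 $ 2 * beta_2sls M D Z Y $ 2"
    by (simp_all only: V_sym)
  moreover have "V $ 1 $ 2 = r * V $ 2 $ 2"
    using V22 by (simp add: r_def)
  ultimately have "cov M Rs Y = cov M Rs Rs * beta_2sls M D Z Y $ 1"
    unfolding var by algebra
  with \<open>cov M Rs Rs \<noteq> 0\<close> show ?thesis
    unfolding Rs_def by simp
qed

end

section \<open>Independence and Fubini\<close>

text \<open>The new elements generate sub-sigma-algebras of the old ones. Asking for measurability
  with respect to \<open>vimage_algebra\<close>, not for a factorization, also covers a change of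
  target space, such as restricting Z to its support.\<close>

lemma indep_elements_compose:
  assumes indep: "indep_elements M N1 X1 N2 X2"
    and Y1: "Y1 \<in> vimage_algebra (space M) X1 N1 \<rightarrow>\<^sub>M K1"
    and Y2: "Y2 \<in> vimage_algebra (space M) X2 N2 \<rightarrow>\<^sub>M K2"
  shows "indep_elements M K1 Y1 K2 Y2"
proof -
  have X: "X1 \<in> M \<rightarrow>\<^sub>M N1" "X2 \<in> M \<rightarrow>\<^sub>M N2"
    and ind: "indep_set (sets (vimage_algebra (space M) X1 N1)) (sets (vimage_algebra (space M) X2 N2))"
    using indep unfolding indep_elements_def by auto
  have sub: "sets (vimage_algebra (space M) Y K) \<subseteq> sets (vimage_algebra (space M) X L)"
    if "Y \<in> vimage_algebra (space M) X L \<rightarrow>\<^sub>M K" for X Y and K :: "'x measure" and L :: "'y measure"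
    using sets_image_in_sets[OF _ that] by simp
  have meas: "Y \<in> M \<rightarrow>\<^sub>M K" if "X \<in> M \<rightarrow>\<^sub>M L" "Y \<in> vimage_algebra (space M) X L \<rightarrow>\<^sub>M K"
    for X Y and K :: "'x measure" and L :: "'y measure"
    using sets_image_in_sets[OF refl that(1)] that(2)
    by (auto simp: measurable_def)
  have "indep_set (sets (vimage_algebra (space M) Y1 K1)) (sets (vimage_algebra (space M) Y2 K2))"
    using ind sub[OF Y1] sub[OF Y2] unfolding indep_sets2_eq by blast
  then show ?thesis
    unfolding indep_elements_def using meas[OF X(1) Y1] meas[OF X(2) Y2] by simp
qed

text \<open>The two measures agree on measurable rectangles by independence, and for sigma-finite
  factors this determines the product measure.\<close>

lemma indep_elements_distr:
  assumes "indep_elements M N1 X1 N2 X2"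
  shows "distr M N1 X1 \<Otimes>\<^sub>M distr M N2 X2 = distr M (N1 \<Otimes>\<^sub>M N2) (\<lambda>\<omega>. (X1 \<omega>, X2 \<omega>))"
proof (rule pair_measure_eqI)
  have X[measurable]: "X1 \<in> M \<rightarrow>\<^sub>M N1" "X2 \<in> M \<rightarrow>\<^sub>M N2"
    and ind: "indep_set (sets (vimage_algebra (space M) X1 N1)) (sets (vimage_algebra (space M) X2 N2))"
    using assms unfolding indep_elements_def by auto
  show "sigma_finite_measure (distr M N1 X1)" "sigma_finite_measure (distr M N2 X2)"
    using prob_space_distr[OF X(1)] prob_space_distr[OF X(2)]
    by (simp_all add: prob_space_imp_sigma_finite)
  show "sets (distr M N1 X1 \<Otimes>\<^sub>M distr M N2 X2) = sets (distr M (N1 \<Otimes>\<^sub>M N2) (\<lambda>\<omega>. (X1 \<omega>, X2 \<omega>)))"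
    by simp
  fix A B assume AB: "A \<in> sets (distr M N1 X1)" "B \<in> sets (distr M N2 X2)"
  then have [measurable]: "A \<in> sets N1" "B \<in> sets N2" by simp_all
  have "prob ((X1 -` A \<inter> space M) \<inter> (X2 -` B \<inter> space M)) =
      prob (X1 -` A \<inter> space M) * prob (X2 -` B \<inter> space M)"
    using ind unfolding indep_sets2_eq by (simp add: in_vimage_algebra)
  moreover have "(\<lambda>\<omega>. (X1 \<omega>, X2 \<omega>)) -` (A \<times> B) \<inter> space M =
      (X1 -` A \<inter> space M) \<inter> (X2 -` B \<inter> space M)"
    by auto
  ultimately show "emeasure (distr M N1 X1) A * emeasure (distr M N2 X2) B =
      emeasure (distr M (N1 \<Otimes>\<^sub>M N2) (\<lambda>\<omega>. (X1 \<omega>, X2 \<omega>))) (A \<times> B)"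
    by (simp add: emeasure_distr emeasure_eq_measure ennreal_mult)
qed

text \<open>Fubini for the joint law, pulled back to M: the first element is frozen at \<omega>
  while the second is averaged over a separate sample point.\<close>

lemma indep_elements_integral_iterated:
  fixes F :: "'b \<times> 'c \<Rightarrow> real"
  assumes ind: "indep_elements M N1 X1 N2 X2" and F[measurable]: "F \<in> borel_measurable (N1 \<Otimes>\<^sub>M N2)"
    and int: "integrable M (\<lambda>\<omega>. F (X1 \<omega>, X2 \<omega>))"
  shows "integrable M (\<lambda>\<omega>. expectation (\<lambda>\<omega>'. F (X1 \<omega>, X2 \<omega>')))"
    and "expectation (\<lambda>\<omega>. F (X1 \<omega>, X2 \<omega>)) =
      expectation (\<lambda>\<omega>. expectation (\<lambda>\<omega>'. F (X1 \<omega>, X2 \<omega>')))"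
proof -
  have X[measurable]: "X1 \<in> M \<rightarrow>\<^sub>M N1" "X2 \<in> M \<rightarrow>\<^sub>M N2"
    using ind unfolding indep_elements_def by auto
  let ?L1 = "distr M N1 X1" and ?L2 = "distr M N2 X2"
  interpret L1: prob_space ?L1 by (rule prob_space_distr) simp
  interpret L2: prob_space ?L2 by (rule prob_space_distr) simp
  interpret pair_sigma_finite ?L1 ?L2 ..
  have int': "integrable (?L1 \<Otimes>\<^sub>M ?L2) F"
    unfolding indep_elements_distr[OF ind] using int by (simp add: integrable_distr_eq)
  have inner: "(\<integral>z. F (x, z) \<partial>?L2) = expectation (\<lambda>\<omega>'. F (x, X2 \<omega>'))" if "x \<in> space N1" for x
    using measurable_Pair2[OF F that] by (subst integral_distr) simp_all
  have [measurable]: "(\<lambda>x. \<integral>z. F (x, z) \<partial>?L2) \<in> borel_measurable N1"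
    by (rule L2.borel_measurable_lebesgue_integral) simp
  have X1: "X1 \<omega> \<in> space N1" if "\<omega> \<in> space M" for \<omega>
    using measurable_space[OF X(1) that] .
  have "integrable M (\<lambda>\<omega>. \<integral>z. F (X1 \<omega>, z) \<partial>?L2)"
    using integrable_fst'[OF int'] by (simp add: integrable_distr_eq)
  then show "integrable M (\<lambda>\<omega>. expectation (\<lambda>\<omega>'. F (X1 \<omega>, X2 \<omega>')))"
    by (rule Bochner_Integration.integrable_cong[THEN iffD1, rotated 2]) (simp_all add: inner X1)
  have "expectation (\<lambda>\<omega>. F (X1 \<omega>, X2 \<omega>)) = integral\<^sup>L (?L1 \<Otimes>\<^sub>M ?L2) F"
    unfolding indep_elements_distr[OF ind] by (simp add: integral_distr)
  also have "\<dots> = (\<integral>x. (\<integral>z. F (x, z) \<partial>?L2) \<partial>?L1)"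
    by (rule integral_fst'[OF int', symmetric])
  also have "\<dots> = expectation (\<lambda>\<omega>. \<integral>z. F (X1 \<omega>, z) \<partial>?L2)"
    by (simp add: integral_distr)
  also have "\<dots> = expectation (\<lambda>\<omega>. expectation (\<lambda>\<omega>'. F (X1 \<omega>, X2 \<omega>')))"
    by (rule Bochner_Integration.integral_cong) (simp_all add: inner X1)
  finally show "expectation (\<lambda>\<omega>. F (X1 \<omega>, X2 \<omega>)) =
      expectation (\<lambda>\<omega>. expectation (\<lambda>\<omega>'. F (X1 \<omega>, X2 \<omega>')))" .
qed

text \<open>Both variables are real, so \<open>indep_var\<close> applies and gives the product rule
  for expectations.\<close>

lemma indep_elements_mult:
  fixes A B :: "'a \<Rightarrow> real"
  assumes ind: "indep_elements M borel A borel B" and "integrable M A" "integrable M B"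
  shows "integrable M (\<lambda>\<omega>. A \<omega> * B \<omega>)"
    and "expectation (\<lambda>\<omega>. A \<omega> * B \<omega>) = expectation A * expectation B"
proof -
  have "indep_var borel A borel B"
    using ind unfolding indep_var_eq indep_elements_def by (simp add: sets_vimage_algebra)
  then show "integrable M (\<lambda>\<omega>. A \<omega> * B \<omega>)"
    and "expectation (\<lambda>\<omega>. A \<omega> * B \<omega>) = expectation A * expectation B"
    using assms(2,3) indep_var_integrable indep_var_lebesgue_integral by blast+
qed

text \<open>The pull-out property: g(S) is measurable for the sigma-algebra generated by S, and b(S)
  is almost surely the conditional expectation of X given that sigma-algebra.\<close>

lemma cond_exp_given_mult:
  assumes S: "S \<in> M \<rightarrow>\<^sub>M N" and b: "cond_exp_given M N S X b"
    and g: "g \<in> borel_measurable N" and X: "X \<in> borel_measurable M"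
    and int: "integrable M (\<lambda>\<omega>. g (S \<omega>) * X \<omega>)"
  shows "integrable M (\<lambda>\<omega>. g (S \<omega>) * b (S \<omega>))"
    and "expectation (\<lambda>\<omega>. g (S \<omega>) * b (S \<omega>)) = expectation (\<lambda>\<omega>. g (S \<omega>) * X \<omega>)"
proof -
  let ?F = "vimage_algebra (space M) S N"
  have sub: "subalgebra M ?F"
    using sets_image_in_sets[OF refl S] by (simp add: subalgebra_def)
  interpret finite_measure_subalgebra M ?F
    by unfold_locales (rule sub)
  have SF: "S \<in> ?F \<rightarrow>\<^sub>M N"
    by (rule measurable_vimage_algebra1) (use measurable_space[OF S] in auto)
  have gS: "(\<lambda>\<omega>. g (S \<omega>)) \<in> borel_measurable ?F"
    using measurable_compose[OF SF g] .
  have bN: "b \<in> borel_measurable N"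
    and ae: "AE \<omega> in M. b (S \<omega>) = real_cond_exp M ?F X \<omega>"
    using b unfolding cond_exp_given_def by auto
  have [measurable]: "(\<lambda>\<omega>. g (S \<omega>)) \<in> borel_measurable M" "(\<lambda>\<omega>. b (S \<omega>)) \<in> borel_measurable M"
    using measurable_compose[OF S g] measurable_compose[OF S bN] by auto
  note ce = real_cond_exp_intg[OF int gS X]
  have ae': "AE \<omega> in M. g (S \<omega>) * b (S \<omega>) = g (S \<omega>) * real_cond_exp M ?F X \<omega>"
    using ae by eventually_elim simp
  show "integrable M (\<lambda>\<omega>. g (S \<omega>) * b (S \<omega>))"
    using ce(1) by (subst integrable_cong_AE[OF _ _ ae']) simp_all
  show "expectation (\<lambda>\<omega>. g (S \<omega>) * b (S \<omega>)) = expectation (\<lambda>\<omega>. g (S \<omega>) * X \<omega>)"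
    using ce(2) by (subst integral_cong_AE[OF _ _ ae']) simp_all
qed

end

theorem proposition1:
  fixes M :: "'a measure"
    and \<Z> :: "(real^'m) set" and Z :: "'a \<Rightarrow> real^'m"
    and N :: "(real^'m \<Rightarrow> nat) measure" and S :: "'a \<Rightarrow> (real^'m \<Rightarrow> nat)"
    and T :: "'a \<Rightarrow> nat" and Yp :: "nat \<Rightarrow> 'a \<Rightarrow> real" and Y :: "'a \<Rightarrow> real"
    and R :: "2 \<Rightarrow> nat set" and p q :: "2 \<Rightarrow> nat" and \<alpha> :: "real \<times> real \<times> real \<Rightarrow> real"
    and D :: "'a \<Rightarrow> real^2" and \<beta> :: "2 \<Rightarrow> 'a \<Rightarrow> real" and b :: "2 \<Rightarrow> (real^'m \<Rightarrow> nat) \<Rightarrow> real"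
  assumes "prob_space M"
    and dim: "2 \<le> CARD('m)"
    and Z_supp: "\<And>\<omega>. \<omega> \<in> space M \<Longrightarrow> Z \<omega> \<in> \<Z>"
    and types: "response_type_space \<Z> N"
    and T_def: "\<And>\<omega>. \<omega> \<in> space M \<Longrightarrow> T \<omega> = S \<omega> (Z \<omega>)"
    and Y_def: "\<And>\<omega>. \<omega> \<in> space M \<Longrightarrow> Y \<omega> = Yp (T \<omega>) \<omega>"
    and R_sub: "\<And>k. R k \<subseteq> {0, 1, 2}"
    and D_def: "D = treat_ind R T"
    and effects: "\<And>k. p k \<in> {0, 1, 2} \<and> q k \<in> {0, 1, 2} \<and> p k \<noteq> q k"
    and beta_def: "\<And>k \<omega>. \<beta> k \<omega> = Yp (p k) \<omega> - Yp (q k) \<omega>"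
    and alpha_meas: "\<alpha> \<in> borel_measurable (borel \<Otimes>\<^sub>M borel \<Otimes>\<^sub>M borel)"
    and decomposition: "\<And>\<omega>. \<omega> \<in> space M \<Longrightarrow>
          Y \<omega> = \<alpha> (Yp 0 \<omega>, Yp 1 \<omega>, Yp 2 \<omega>) + D \<omega> $ 1 * \<beta> 1 \<omega> + D \<omega> $ 2 * \<beta> 2 \<omega>"
    and moments_Y: "\<And>t. t \<in> {0, 1, 2} \<Longrightarrow> integrable M (Yp t)"
    and moments_Z: "\<And>i. integrable M (\<lambda>\<omega>. (Z \<omega> $ i)\<^sup>2)"
    and var_Z: "invertible (cov_mat M Z Z)"
    and exogeneity: "indep_elements M (borel \<Otimes>\<^sub>M borel \<Otimes>\<^sub>M borel \<Otimes>\<^sub>M N)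
          (\<lambda>\<omega>. (Yp 0 \<omega>, Yp 1 \<omega>, Yp 2 \<omega>, S \<omega>)) borel Z"
    and rank_condition: "rank (cov_mat M Z D) = 2"
    and b_version: "\<And>k. cond_exp_given M N S (\<beta> k) (b k)"
  shows "integrable M (\<lambda>\<omega>. tsls_weight M R D Z 1 (S \<omega>) * b 1 (S \<omega>) +
                            tsls_weight M R D Z 2 (S \<omega>) * b 2 (S \<omega>)) \<and>
         beta_2sls M D Z Y $ 1 =
           (\<integral>\<omega>. tsls_weight M R D Z 1 (S \<omega>) * b 1 (S \<omega>) +
                 tsls_weight M R D Z 2 (S \<omega>) * b 2 (S \<omega>) \<partial>M)"
proof -
  interpret prob_space M by fact
  let ?W = "\<lambda>\<omega>. (Yp 0 \<omega>, Yp 1 \<omega>, Yp 2 \<omega>, S \<omega>)"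
  let ?NW = "borel \<Otimes>\<^sub>M borel \<Otimes>\<^sub>M borel \<Otimes>\<^sub>M N :: (real \<times> real \<times> real \<times> (real^'m \<Rightarrow> nat)) measure"
  \<comment> \<open>The sigma-algebra of potential outcomes and response type, all of which is
    independent of Z.\<close>
  let ?F = "vimage_algebra (space M) ?W ?NW"
  let ?FZ = "vimage_algebra (space M) Z borel"
  let ?B = "restrict_space borel \<Z>"
  define X where "X = resid_pred M D Z"
  define \<mu> where "\<mu> = expectation X"
  define \<alpha>Y where "\<alpha>Y = (\<lambda>\<omega>. \<alpha> (Yp 0 \<omega>, Yp 1 \<omega>, Yp 2 \<omega>))"

  \<comment> \<open>Variables determined by potential outcomes and response type\<close>
  have W: "?W \<in> M \<rightarrow>\<^sub>M ?NW" and Z[measurable]: "Z \<in> borel_measurable M"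
    using exogeneity unfolding indep_elements_def by auto
  have WF: "?W \<in> ?F \<rightarrow>\<^sub>M ?NW"
    using measurable_space[OF W] by (intro measurable_vimage_algebra1) blast
  have F_le: "sets ?F \<subseteq> sets M"
    by (rule sets_image_in_sets[OF refl W])
  have YpF: "Yp 0 \<in> borel_measurable ?F" "Yp 1 \<in> borel_measurable ?F" "Yp 2 \<in> borel_measurable ?F"
    and SF: "S \<in> ?F \<rightarrow>\<^sub>M N"
    using measurable_compose[OF WF measurable_fst]
      measurable_compose[OF WF measurable_compose[OF measurable_snd measurable_fst]]
      measurable_compose[OF WF measurable_compose[OF measurable_snd
        measurable_compose[OF measurable_snd measurable_fst]]]
      measurable_compose[OF WF measurable_compose[OF measurable_snd
        measurable_compose[OF measurable_snd measurable_snd]]]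
    by simp_all
  have YpF': "Yp t \<in> borel_measurable ?F" if "t \<in> {0, 1, 2}" for t
    using that YpF by auto
  have \<beta>F: "\<beta> k \<in> borel_measurable ?F" for k
    unfolding beta_def[abs_def] using effects[of k] by (intro borel_measurable_diff YpF') auto
  have \<alpha>F: "\<alpha>Y \<in> borel_measurable ?F"
    unfolding \<alpha>Y_def using YpF by (intro measurable_compose[OF _ alpha_meas] measurable_Pair)
  have FM: "f \<in> M \<rightarrow>\<^sub>M K" if "f \<in> ?F \<rightarrow>\<^sub>M K" for f and K :: "'k measure"
    using that F_le by (auto simp: measurable_def)
  have S[measurable]: "S \<in> M \<rightarrow>\<^sub>M N" by (rule FM[OF SF])
  have \<beta>M[measurable]: "\<beta> k \<in> borel_measurable M" for k by (rule FM[OF \<beta>F])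
  have \<alpha>M[measurable]: "\<alpha>Y \<in> borel_measurable M" by (rule FM[OF \<alpha>F])

  \<comment> \<open>Independence from the instrument\<close>
  have Z_FZ: "Z \<in> ?FZ \<rightarrow>\<^sub>M borel"
    by (rule measurable_vimage_algebra1) simp
  \<comment> \<open>Evaluation of response types is measurable only over the support
    \<open>\<Z>\<close>, so Z is regarded as an element of the restricted space.\<close>
  have Z_res: "Z \<in> ?FZ \<rightarrow>\<^sub>M ?B"
    using Z_supp by (intro measurable_restrict_space2 Z_FZ) simp
  have ind: "indep_elements M borel f borel (\<lambda>\<omega>. g (Z \<omega>))"
    if "f \<in> borel_measurable ?F" "g \<in> borel_measurable borel" for f g :: "_ \<Rightarrow> real"
    by (rule indep_elements_compose[OF exogeneity that(1) measurable_compose[OF Z_FZ that(2)]])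
  have ind_\<beta>S: "indep_elements M (borel \<Otimes>\<^sub>M N) (\<lambda>\<omega>. (\<beta> k \<omega>, S \<omega>)) ?B Z" for k
    by (rule indep_elements_compose[OF exogeneity measurable_Pair[OF \<beta>F SF] Z_res])

  \<comment> \<open>Evaluation of response types and the treatment\<close>
  have eval: "(\<lambda>(s, z). s z) \<in> N \<Otimes>\<^sub>M ?B \<rightarrow>\<^sub>M count_space {0, 1, 2::nat}"
    and N_sub: "space N \<subseteq> \<Z> \<rightarrow>\<^sub>E {0, 1, 2}"
    using types unfolding response_type_space_def by auto
  have ind_eval[measurable]: "(\<lambda>(s, z). indicator (R k) (s z) :: real) \<in> borel_measurable (N \<Otimes>\<^sub>M ?B)" for k
    using measurable_compose[OF eval, of "indicator (R k)" borel] by (simp add: split_beta')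
  have Z_res_M[measurable]: "Z \<in> M \<rightarrow>\<^sub>M ?B"
    using Z_supp by (intro measurable_restrict_space2 Z) simp
  have ind_sZ: "(\<lambda>\<omega>. indicator (R k) (s (Z \<omega>)) :: real) \<in> borel_measurable M" if "s \<in> space N" for k s
    using measurable_compose[OF measurable_Pair[OF measurable_const[OF that] Z_res_M] ind_eval] by simp
  have ind_T: "(\<lambda>\<omega>. indicator (R k) (T \<omega>) :: real) \<in> borel_measurable M" for k
    using measurable_compose[OF measurable_Pair[OF S Z_res_M] ind_eval[of k]]
    by (simp add: T_def cong: measurable_cong)
  have T_range: "T \<omega> \<in> {0, 1, 2}" if "\<omega> \<in> space M" for \<omega>
    using PiE_mem[OF subsetD[OF N_sub measurable_space[OF S that]] Z_supp[OF that]] T_def[OF that] by simp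
  have D_nth: "D \<omega> $ k = indicator (R k) (T \<omega>)" for \<omega> k
    by (simp add: D_def treat_ind_def)

  \<comment> \<open>Integrability of the outcome and its components\<close>
  have bounded_mult: "integrable M (\<lambda>\<omega>. indicator C (f \<omega>) * g \<omega>)"
    if "(\<lambda>\<omega>. indicator C (f \<omega>) :: real) \<in> borel_measurable M" "integrable M g"
    for C :: "nat set" and f and g :: "'a \<Rightarrow> real"
    using that by (intro Bochner_Integration.integrable_bound[OF that(2)] borel_measurable_times AE_I2)
      (auto simp: indicator_def)
  have \<beta>_int: "integrable M (\<beta> k)" for k
    unfolding beta_def[abs_def] using effects[of k] moments_Y by simp
  have Y_meas[measurable]: "Y \<in> borel_measurable M"
  proof -
    have "(\<lambda>\<omega>. \<alpha>Y \<omega> + indicator (R 1) (T \<omega>) * \<beta> 1 \<omega> + indicator (R 2) (T \<omega>) * \<beta> 2 \<omega>)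
        \<in> borel_measurable M"
      using ind_T[measurable] by simp
    then show ?thesis
      by (rule measurable_cong[THEN iffD2, rotated]) (simp add: decomposition D_nth \<alpha>Y_def)
  qed
  \<comment> \<open>Y may depend on Z through T, so the product rule for independent variables
    cannot be applied to Y directly. But |Y| is at most the sum of the |Y(t)|, each of which is
    independent of Z.\<close>
  have Y_mult: "integrable M (\<lambda>\<omega>. Y \<omega> * g (Z \<omega>))"
    if g: "g \<in> borel_measurable borel" and int: "integrable M (\<lambda>\<omega>. g (Z \<omega>))" for g
  proof (rule Bochner_Integration.integrable_bound)
    have "integrable M (\<lambda>\<omega>. Yp t \<omega> * g (Z \<omega>))" if "t \<in> {0, 1, 2}" for t
      by (rule indep_elements_mult(1)[OF ind[OF YpF'[OF that] g] moments_Y[OF that] int])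
    then show "integrable M (\<lambda>\<omega>. \<Sum>t\<in>{0, 1, 2}. \<bar>Yp t \<omega> * g (Z \<omega>)\<bar>)"
      by (intro Bochner_Integration.integrable_sum integrable_abs)
    show "AE \<omega> in M. norm (Y \<omega> * g (Z \<omega>)) \<le> norm (\<Sum>t\<in>{0, 1, 2}. \<bar>Yp t \<omega> * g (Z \<omega>)\<bar>)"
    proof (rule AE_I2)
      fix \<omega> assume "\<omega> \<in> space M"
      then have "\<bar>Y \<omega> * g (Z \<omega>)\<bar> \<le> (\<Sum>t\<in>{0, 1, 2}. \<bar>Yp t \<omega> * g (Z \<omega>)\<bar>)"
        unfolding Y_def[OF \<open>\<omega> \<in> space M\<close>] by (intro member_le_sum T_range) simp_all
      then show "norm (Y \<omega> * g (Z \<omega>)) \<le> norm (\<Sum>t\<in>{0, 1, 2}. \<bar>Yp t \<omega> * g (Z \<omega>)\<bar>)"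
        unfolding real_norm_def by linarith
    qed
    show "(\<lambda>\<omega>. Y \<omega> * g (Z \<omega>)) \<in> borel_measurable M"
      using measurable_compose[OF Z g] by simp
  qed
  have "integrable M (\<lambda>\<omega>. Y \<omega> * 1)" by (rule Y_mult) simp_all
  then have Y_int: "integrable M Y" by simp
  \<comment> \<open>In the decomposition \<alpha> is what remains of Y after subtracting integrable
    terms.\<close>
  have \<alpha>_int: "integrable M \<alpha>Y"
  proof -
    have "integrable M (\<lambda>\<omega>. Y \<omega> - indicator (R 1) (T \<omega>) * \<beta> 1 \<omega> - indicator (R 2) (T \<omega>) * \<beta> 2 \<omega>)"
      by (intro Bochner_Integration.integrable_diff Y_int bounded_mult ind_T \<beta>_int)
    then show ?thesis
      by (rule Bochner_Integration.integrable_cong[THEN iffD1, rotated 2])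
        (simp_all add: decomposition D_nth \<alpha>Y_def)
  qed

  \<comment> \<open>The residual as a centered function of the instrument\<close>
  have Z_nth: "(\<lambda>z::real^'m. z $ i) \<in> borel_measurable borel" for i
    by (intro borel_measurable_continuous_onI continuous_intros)
  have Z_nth_M: "(\<lambda>\<omega>. Z \<omega> $ i) \<in> borel_measurable M" for i
    by (rule measurable_compose[OF Z Z_nth])
  have Z_int: "integrable M (\<lambda>\<omega>. Z \<omega> $ i)" for i
    by (rule integrable_instrument[OF Z_nth_M moments_Z])
  have X_int: "integrable M X"
    unfolding X_def by (rule integrable_resid_pred[OF Z_nth_M moments_Z])
  obtain h where h[measurable]: "h \<in> borel_measurable borel" and Xh: "X = (\<lambda>\<omega>. h (Z \<omega>))"
    unfolding X_def by (rule resid_pred_eq_measurable)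
  have h_res[measurable]: "h \<in> borel_measurable ?B"
    by (rule measurable_restrict_space1[OF h])
  have hc_int: "integrable M (\<lambda>\<omega>. h (Z \<omega>) - \<mu>)"
    using X_int by (simp add: Xh)
  have hc_zero: "expectation (\<lambda>\<omega>. h (Z \<omega>) - \<mu>) = 0"
    using X_int by (simp add: Xh \<mu>_def prob_space)

  \<comment> \<open>Numerators of the weights\<close>
  define G where "G k s = cov M X (\<lambda>\<omega>. indicator (R k) (s (Z \<omega>)))" for k s
  have G_eq: "G k s = expectation (\<lambda>\<omega>. (h (Z \<omega>) - \<mu>) * indicator (R k) (s (Z \<omega>)))"
    if "s \<in> space N" for k s
  proof -
    have "integrable M (\<lambda>\<omega>. indicator (R k) (s (Z \<omega>)) * (1::real))"
      "integrable M (\<lambda>\<omega>. indicator (R k) (s (Z \<omega>)) * X \<omega>)"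
      by (intro bounded_mult ind_sZ that X_int integrable_const)+
    then show ?thesis
      unfolding G_def using X_int
      by (subst cov_eq_centered_integral(2)) (simp_all add: mult.commute Xh \<mu>_def)
  qed
  \<comment> \<open>As an integral with parameter s, this is measurable because evaluation is
    jointly measurable in s and the sample point.\<close>
  have G_meas: "G k \<in> borel_measurable N" for k
  proof -
    have "(\<lambda>x. indicator (R k) (fst x (Z (snd x))) :: real) \<in> borel_measurable (N \<Otimes>\<^sub>M M)"
      using measurable_compose[OF measurable_Pair[OF measurable_fst
          measurable_compose[OF measurable_snd Z_res_M]] ind_eval[of k]] by simp
    then have "(\<lambda>s. expectation (\<lambda>\<omega>. (h (Z \<omega>) - \<mu>) * indicator (R k) (s (Z \<omega>)))) \<in> borel_measurable N"
      by (intro borel_measurable_lebesgue_integral) (simp add: split_beta')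
    then show ?thesis
      by (rule measurable_cong[THEN iffD2, rotated]) (rule G_eq)
  qed

  \<comment> \<open>Contribution of a single treatment effect\<close>
  have effect_term:
    "integrable M (\<lambda>\<omega>. (h (Z \<omega>) - \<mu>) * (D \<omega> $ k * \<beta> k \<omega>))"
    "integrable M (\<lambda>\<omega>. G k (S \<omega>) * b k (S \<omega>))"
    "expectation (\<lambda>\<omega>. (h (Z \<omega>) - \<mu>) * (D \<omega> $ k * \<beta> k \<omega>)) =
      expectation (\<lambda>\<omega>. G k (S \<omega>) * b k (S \<omega>))" for k
  proof -
    \<comment> \<open>The arguments are grouped as ((effect, type), instrument), with the
      independence \<open>ind_\<beta>S\<close> falling between the two outer components.\<close>
    define f :: "(real \<times> (real^'m \<Rightarrow> nat)) \<times> (real^'m) \<Rightarrow> real" where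
      "f = (\<lambda>x. (h (snd x) - \<mu>) * (indicator (R k) (snd (fst x) (snd x)) * fst (fst x)))"
    have "(\<lambda>x. indicator (R k) (snd (fst x) (snd x)) :: real)
        \<in> borel_measurable ((borel \<Otimes>\<^sub>M N) \<Otimes>\<^sub>M ?B)"
      using measurable_compose[OF measurable_Pair[OF
          measurable_compose[OF measurable_fst measurable_snd] measurable_snd] ind_eval[of k]]
      by simp
    then have f: "f \<in> borel_measurable ((borel \<Otimes>\<^sub>M N) \<Otimes>\<^sub>M ?B)"
      unfolding f_def by simp
    have "integrable M (\<lambda>\<omega>. \<beta> k \<omega> * (h (Z \<omega>) - \<mu>))"
      using indep_elements_mult(1)[OF ind[OF \<beta>F, of "\<lambda>z. h z - \<mu>"] \<beta>_int hc_int] by simp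
    from bounded_mult[OF ind_T this]
    show int: "integrable M (\<lambda>\<omega>. (h (Z \<omega>) - \<mu>) * (D \<omega> $ k * \<beta> k \<omega>))"
      by (simp add: D_nth mult_ac)
    have f_eq: "f ((\<beta> k \<omega>, S \<omega>), Z \<omega>) = (h (Z \<omega>) - \<mu>) * (D \<omega> $ k * \<beta> k \<omega>)"
      if "\<omega> \<in> space M" for \<omega>
      by (simp add: f_def D_nth T_def[OF that])
    have f_int: "integrable M (\<lambda>\<omega>. f ((\<beta> k \<omega>, S \<omega>), Z \<omega>))"
      using int by (rule Bochner_Integration.integrable_cong[THEN iffD2, rotated 2]) (simp_all add: f_eq)
    \<comment> \<open>With effect and type frozen, the effect factors out, and averaging over Z
      alone leaves the numerator of the weight at that type.\<close>
    have inner: "expectation (\<lambda>\<omega>'. f ((\<beta> k \<omega>, S \<omega>), Z \<omega>')) = G k (S \<omega>) * \<beta> k \<omega>"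
      if "\<omega> \<in> space M" for \<omega>
      by (simp add: f_def G_eq measurable_space[OF S that] flip: mult.assoc)
    note fubini = indep_elements_integral_iterated[OF ind_\<beta>S f f_int]
    have G\<beta>: "integrable M (\<lambda>\<omega>. G k (S \<omega>) * \<beta> k \<omega>)"
      using fubini(1) by (rule Bochner_Integration.integrable_cong[THEN iffD1, rotated 2])
        (simp_all add: inner)
    note cond = cond_exp_given_mult[where g = "G k", OF S b_version[of k] G_meas[of k] \<beta>M[of k], OF G\<beta>]
    show "integrable M (\<lambda>\<omega>. G k (S \<omega>) * b k (S \<omega>))" by (rule cond(1))
    have "expectation (\<lambda>\<omega>. (h (Z \<omega>) - \<mu>) * (D \<omega> $ k * \<beta> k \<omega>)) =
        expectation (\<lambda>\<omega>. f ((\<beta> k \<omega>, S \<omega>), Z \<omega>))"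
      by (rule Bochner_Integration.integral_cong) (simp_all add: f_eq)
    also have "\<dots> = expectation (\<lambda>\<omega>. expectation (\<lambda>\<omega>'. f ((\<beta> k \<omega>, S \<omega>), Z \<omega>')))"
      by (rule fubini(2))
    also have "\<dots> = expectation (\<lambda>\<omega>. G k (S \<omega>) * \<beta> k \<omega>)"
      by (rule Bochner_Integration.integral_cong) (simp_all add: inner)
    finally show "expectation (\<lambda>\<omega>. (h (Z \<omega>) - \<mu>) * (D \<omega> $ k * \<beta> k \<omega>)) =
        expectation (\<lambda>\<omega>. G k (S \<omega>) * b k (S \<omega>))"
      by (simp add: cond(2))
  qed

  \<comment> \<open>Covariance of the residual with the outcome\<close>
  have "indep_elements M borel \<alpha>Y borel (\<lambda>\<omega>. h (Z \<omega>) - \<mu>)"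
    using ind[OF \<alpha>F, of "\<lambda>z. h z - \<mu>"] by simp
  \<comment> \<open>The expectation factors into E[\<alpha>] times the mean of the centered
    residual, which is zero by \<open>hc_zero\<close>.\<close>
  note \<alpha>_term = indep_elements_mult[OF this \<alpha>_int hc_int]
  have XY: "integrable M (\<lambda>\<omega>. X \<omega> * Y \<omega>)"
    using Y_mult[OF h] X_int by (simp add: Xh mult.commute)
  have "cov M X Y = expectation (\<lambda>\<omega>. (h (Z \<omega>) - \<mu>) * Y \<omega>)"
    using cov_eq_centered_integral(2)[OF X_int Y_int XY] by (simp add: Xh \<mu>_def)
  also have "\<dots> = expectation (\<lambda>\<omega>. \<alpha>Y \<omega> * (h (Z \<omega>) - \<mu>)
      + (h (Z \<omega>) - \<mu>) * (D \<omega> $ 1 * \<beta> 1 \<omega>) + (h (Z \<omega>) - \<mu>) * (D \<omega> $ 2 * \<beta> 2 \<omega>))"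
    by (rule Bochner_Integration.integral_cong) (simp_all add: decomposition \<alpha>Y_def algebra_simps)
  also have "\<dots> = expectation (\<lambda>\<omega>. G 1 (S \<omega>) * b 1 (S \<omega>)) + expectation (\<lambda>\<omega>. G 2 (S \<omega>) * b 2 (S \<omega>))"
    using \<alpha>_term effect_term by (simp add: hc_zero)
  finally have cov_XY: "cov M X Y =
      expectation (\<lambda>\<omega>. G 1 (S \<omega>) * b 1 (S \<omega>)) + expectation (\<lambda>\<omega>. G 2 (S \<omega>) * b 2 (S \<omega>))" .

  \<comment> \<open>Normalization by the variance of the residual\<close>
  have "beta_2sls M D Z Y $ 1 = cov M X Y / cov M X X"
    unfolding X_def
    by (rule beta_2sls_1_eq_residual_regression[OF Z_nth_M moments_Z var_Z rank_condition Y_int])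
      (rule Y_mult[OF Z_nth Z_int])
  moreover have "tsls_weight M R D Z k s = G k s / cov M X X" for k s
    by (simp add: tsls_weight_def G_def X_def)
  ultimately show ?thesis
    using effect_term(2)[of 1] effect_term(2)[of 2] by (simp add: cov_XY add_divide_distrib)
qed

end
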